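(* Let $z=(z_1,\dots,z_n)$ where $z_1,\dots,z_n$ are i.i.d. draws from a continuous distribution on $\mathbb{R}$ with a density. Let $J$ be a positive integer with $J\le\sqrt{n}$. Let the parameter space be $\{(\tau,\mu)\in\mathbb{R}^J\times\mathbb{R}^J:\tau_j>0\ \forall j,\ \sum_{j=1}^J\tau_j=1,\ \mu_1<\mu_2<\dots<\mu_J\}$, and let $Q(\tau,\mu,z)=-\sum_{i=1}^n\log f(z_i;\tau,\mu)$ with $f(x;\tau,\mu)=\sum_{j=1}^J\tau_j\phi(x-\mu_j)$, where $\phi$ is the standard normal density. Then the argmin of $Q(\tau,\mu,z)$ over this parameter space is unique almost surely (it contains at most one point for almost every $z$).
   Context: The model need not be correctly specified; $\phi$ denotes the standard normal density. *)

theory Defs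
  imports "HOL-Probability.Probability"
begin

text \<open>Parameters are pairs (tau, mu) of real sequences; only indices j < J are meaningful
  (0-based: index j corresponds to the paper's j+1). To make the parameter space a faithful copy of
  R^J x R^J we require tau and mu to vanish outside {..<J}.\<close>

definition mix_param_space :: "nat \<Rightarrow> ((nat \<Rightarrow> real) \<times> (nat \<Rightarrow> real)) set" where
  "mix_param_space J = {(\<tau>, \<mu>).
      (\<forall>j<J. \<tau> j > 0) \<and> (\<Sum>j<J. \<tau> j) = 1 \<and>
      (\<forall>j. Suc j < J \<longrightarrow> \<mu> j < \<mu> (Suc j)) \<and>
      (\<forall>j\<ge>J. \<tau> j = 0 \<and> \<mu> j = 0)}"

definition mix_density :: "nat \<Rightarrow> (nat \<Rightarrow> real) \<Rightarrow> (nat \<Rightarrow> real) \<Rightarrow> real \<Rightarrow> real" where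
  "mix_density J \<tau> \<mu> x = (\<Sum>j<J. \<tau> j * std_normal_density (x - \<mu> j))"

definition mix_Q :: "nat \<Rightarrow> nat \<Rightarrow> (nat \<Rightarrow> real) \<Rightarrow> (nat \<Rightarrow> real) \<Rightarrow> (nat \<Rightarrow> real) \<Rightarrow> real" where
  "mix_Q n J \<tau> \<mu> z = - (\<Sum>i<n. ln (mix_density J \<tau> \<mu> (z i)))"

definition mix_argmin :: "nat \<Rightarrow> nat \<Rightarrow> (nat \<Rightarrow> real) \<Rightarrow> ((nat \<Rightarrow> real) \<times> (nat \<Rightarrow> real)) set" where
  "mix_argmin n J z = {p \<in> mix_param_space J.
      \<forall>q \<in> mix_param_space J. mix_Q n J (fst p) (snd p) z \<le> mix_Q n J (fst q) (snd q) z}"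

end

theory Submission
  imports Defs
begin

text \<open>Up to a term depending on \<open>z\<close> only, \<open>- Q\<close> is a sum over \<open>i\<close> of functions of \<open>z i\<close> that are convex
  for each parameter, so their supremum \<open>W z\<close> over the parameters is convex. At a \<open>z\<close> with
  two optimal parameters \<open>W\<close> lies above the tangents of both. If these
  have different slopes in direction \<open>i\<close>, then \<open>z\<close> is, for some rational \<open>r\<close>, the unique minimum of
  \<open>W - r * z i\<close> on its line in direction \<open>i\<close>; for fixed \<open>i\<close> and \<open>r\<close> such points form a null set
  by Fubini. If all slopes agree at \<open>n \<ge> J\<^sup>2\<close> distinct points, then the Wronskian of the
  two mixtures, a Gaussian times an exponential sum with at most \<open>J\<^sup>2\<close> exponents, vanishes
  identically, so the mixtures are proportional and hence have the same parameters.\<close>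

section \<open>Zeros of exponential sums\<close>

text \<open>Rolle between consecutive zeros. Points are added in increasing order, and the bound by
  \<open>Max Z\<close> in the claim is what keeps each new zero of \<open>G'\<close> apart from the
  earlier ones.\<close>

lemma rolle_card:
  fixes G G' :: "real \<Rightarrow> real"
  assumes "finite Z" "Z \<noteq> {}"
    and deriv: "\<And>x. (G has_real_derivative G' x) (at x)"
    and "\<And>x. x \<in> Z \<Longrightarrow> G x = 0"
  shows "\<exists>Y. finite Y \<and> Suc (card Y) = card Z \<and> (\<forall>y\<in>Y. G' y = 0 \<and> y < Max Z)"
  using assms(1,2,4)
proof (induction Z rule: finite_linorder_max_induct)
  case empty
  then show ?case by simp
next
  case (insert b Z)
  have max_b: "Max (insert b Z) = b"
    using insert.hyps by (intro Max_eqI) (auto intro: less_imp_le)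
  show ?case
  proof (cases "Z = {}")
    case True
    then show ?thesis by (intro exI[of _ "{}"]) auto
  next
    case False
    then obtain Y where Y: "finite Y" "Suc (card Y) = card Z"
        "\<And>y. y \<in> Y \<Longrightarrow> G' y = 0 \<and> y < Max Z"
      using insert by auto
    have M: "Max Z \<in> Z" using False insert.hyps by simp
    then have less: "Max Z < b" using insert.hyps by blast
    have "\<exists>c. Max Z < c \<and> c < b \<and> (\<lambda>v. v * G' c) = (\<lambda>v. 0)"
    proof (rule Rolle_deriv[OF less])
      show "G (Max Z) = G b" using M insert.prems by simp
      show "continuous_on {Max Z..b} G"
        using deriv by (meson DERIV_isCont continuous_at_imp_continuous_on)
      show "(G has_derivative (\<lambda>v. v * G' x)) (at x)" for x
        using deriv[of x] by (simp add: has_field_derivative_def mult_commute_abs)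
    qed
    then obtain c where c: "Max Z < c" "c < b" "G' c = 0"
      by (metis mult_1)
    have "c \<notin> Y" using Y c by force
    moreover have "b \<notin> Z" using insert.hyps by blast
    moreover have "\<And>y. y \<in> Y \<Longrightarrow> y < b" using Y less by force
    ultimately show ?thesis
      using Y c insert.hyps max_b by (intro exI[of _ "insert c Y"]) auto
  qed
qed

text \<open>Induction on the exponents: each step removes one exponent by differentiation and loses
  one zero by Rolle. The coefficients change on the way, so \<open>c\<close> is generalised.\<close>

lemma exp_sum_coeffs_zero:
  fixes c :: "real \<Rightarrow> real"
  assumes "finite A" "finite Z" "card A \<le> card Z"
    and "\<And>x. x \<in> Z \<Longrightarrow> (\<Sum>a\<in>A. c a * exp (a * x)) = 0"
    and "a \<in> A"
  shows "c a = 0"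
  using assms
proof (induction A arbitrary: c Z a rule: finite_induct)
  case empty
  then show ?case by simp
next
  case (insert b A)
  \<comment> \<open>Multiplying by \<open>exp (- b * x)\<close> keeps the zeros and makes the
    \<open>b\<close>-term constant, so it disappears from \<open>G'\<close>.\<close>
  define G where "G = (\<lambda>x. \<Sum>a\<in>insert b A. c a * exp ((a - b) * x))"
  define G' where "G' = (\<lambda>x. \<Sum>a\<in>insert b A. c a * ((a - b) * exp ((a - b) * x)))"
  have shift: "(\<Sum>a\<in>S. k a * exp ((a - b) * x)) = exp (- b * x) * (\<Sum>a\<in>S. k a * exp (a * x))"
    for S k x
    by (simp add: sum_distrib_left exp_add[symmetric] algebra_simps)
  have Z: "Z \<noteq> {}" using insert by auto
  have "(G has_real_derivative G' x) (at x)" for x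
    unfolding G_def G'_def by (intro DERIV_sum) (auto intro!: derivative_eq_intros)
  moreover have "G x = 0" if "x \<in> Z" for x
    unfolding G_def shift using insert.prems(3)[OF that] by simp
  ultimately obtain Y where Y: "finite Y" "Suc (card Y) = card Z" "\<And>y. y \<in> Y \<Longrightarrow> G' y = 0"
    using rolle_card[of Z G G'] insert.prems Z by blast
  have c0: "c a * (a - b) = 0" if "a \<in> A" for a
  proof (rule insert.IH[of Y "\<lambda>a. c a * (a - b)"])
    show "card A \<le> card Y" using Y insert by simp
    show "(\<Sum>a\<in>A. c a * (a - b) * exp (a * x)) = 0" if "x \<in> Y" for x
    proof -
      have "G' x = (\<Sum>a\<in>A. (c a * (a - b)) * exp ((a - b) * x))"
        unfolding G'_def using insert.hyps by (simp add: mult.assoc)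
      then show ?thesis using Y(3)[OF that] unfolding shift by simp
    qed
  qed (use Y that in auto)
  then have c0: "c a = 0" if "a \<in> A" for a using that insert.hyps by fastforce
  \<comment> \<open>Only the \<open>b\<close>-term is left, and a single zero settles it.\<close>
  obtain x where "x \<in> Z" using Z by blast
  then have "c b * exp (b * x) = 0"
    using insert.prems(3)[of x] insert.hyps c0 by simp
  then show ?case using c0 insert.prems by auto
qed

text \<open>Exponents may coincide here, so single coefficients need not vanish; collecting equal
  exponents reduces to distinct ones.\<close>

lemma exp_sum_identically_zero:
  fixes e c :: "'i \<Rightarrow> real"
  assumes I: "finite I" and Z: "finite Z" "card I \<le> card Z"
    and zero: "\<And>x. x \<in> Z \<Longrightarrow> (\<Sum>i\<in>I. c i * exp (e i * x)) = 0"
  shows "(\<Sum>i\<in>I. c i * exp (e i * y)) = 0"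
proof -
  define k where "k a = (\<Sum>i | i \<in> I \<and> e i = a. c i)" for a
  have eq: "(\<Sum>i\<in>I. c i * exp (e i * x)) = (\<Sum>a\<in>e ` I. k a * exp (a * x))" for x
    unfolding sum.image_gen[OF I, of _ e] k_def sum_distrib_right
    by (intro sum.cong) auto
  have "k a = 0" if "a \<in> e ` I" for a
    using exp_sum_coeffs_zero[of "e ` I" Z k a] I Z card_image_le[OF I, of e] zero that
    unfolding eq by auto
  then show ?thesis unfolding eq by simp
qed

lemma strict_mono_on_image_unique:
  fixes f g :: "nat \<Rightarrow> 'a :: linorder"
  assumes "strict_mono_on {..<J} f" "strict_mono_on {..<J} g" "f ` {..<J} = g ` {..<J}" "j < J"
  shows "f j = g j"
proof -
  have sd: "sorted (map h [0..<J])" "distinct (map h [0..<J])"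
    if "strict_mono_on {..<J} h" for h :: "nat \<Rightarrow> 'a"
  proof -
    show "sorted (map h [0..<J])"
      using that by (auto simp: sorted_iff_nth_mono strict_mono_on_leD)
    show "distinct (map h [0..<J])"
      using strict_mono_on_imp_inj_on[OF that] by (simp add: distinct_map atLeast0LessThan)
  qed
  have "map f [0..<J] = map g [0..<J]"
    by (rule sorted_distinct_set_unique) (use sd assms in \<open>auto simp: atLeast0LessThan\<close>)
  then show ?thesis using assms(4) by (auto dest: map_eq_conv[THEN iffD1])
qed

section \<open>Tilted mixtures\<close>

text \<open>\<open>tilt J p\<close> is the mixture density divided by the standard normal density. Its logarithm is
  convex, unlike that of the mixture density.\<close>

definition tilt :: "nat \<Rightarrow> (nat \<Rightarrow> real) \<times> (nat \<Rightarrow> real) \<Rightarrow> real \<Rightarrow> real" where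
  "tilt J p x = (\<Sum>j<J. fst p j * exp (snd p j * x - (snd p j)\<^sup>2 / 2))"

definition dtilt :: "nat \<Rightarrow> (nat \<Rightarrow> real) \<times> (nat \<Rightarrow> real) \<Rightarrow> real \<Rightarrow> real" where
  "dtilt J p x = (\<Sum>j<J. fst p j * exp (snd p j * x - (snd p j)\<^sup>2 / 2) * snd p j)"

definition tilt_loglik :: "nat \<Rightarrow> nat \<Rightarrow> (nat \<Rightarrow> real) \<times> (nat \<Rightarrow> real) \<Rightarrow> (nat \<Rightarrow> real) \<Rightarrow> real" where
  "tilt_loglik n J p z = (\<Sum>i<n. ln (tilt J p (z i)))"

lemma param_spaceD:
  assumes "p \<in> mix_param_space J"
  shows "j < J \<Longrightarrow> fst p j > 0" "(\<Sum>j<J. fst p j) = 1" "Suc j < J \<Longrightarrow> snd p j < snd p (Suc j)"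
    "\<not> j < J \<Longrightarrow> fst p j = 0" "\<not> j < J \<Longrightarrow> snd p j = 0" "J > 0"
  using assms by (auto simp: mix_param_space_def intro: Nat.gr0I)

lemma param_space_strict_mono:
  assumes "p \<in> mix_param_space J"
  shows "strict_mono_on {..<J} (snd p)"
proof (rule strict_mono_onI)
  fix i j assume "i \<in> {..<J}" "j \<in> {..<J}" "i < j"
  from \<open>i < j\<close> have "j < J \<longrightarrow> snd p i < snd p j"
  proof (induction rule: less_Suc_induct)
    case (1 i)
    then show ?case using param_spaceD(3)[OF assms] by simp
  next
    case (2 i j k)
    then show ?case by auto
  qed
  then show "snd p i < snd p j" using \<open>j \<in> {..<J}\<close> by simp
qed

lemma tilt_pos:
  assumes "p \<in> mix_param_space J"
  shows "tilt J p x > 0"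
  unfolding tilt_def using param_spaceD[OF assms] by (intro sum_pos) auto

text \<open>Complete the square in each exponent. The bound is uniform in \<open>p\<close>, so
  suprema over parameters are finite.\<close>

lemma tilt_le:
  assumes "p \<in> mix_param_space J"
  shows "tilt J p x \<le> exp (x\<^sup>2 / 2)"
proof -
  have "tilt J p x \<le> (\<Sum>j<J. fst p j * exp (x\<^sup>2 / 2))"
    unfolding tilt_def
  proof (intro sum_mono mult_left_mono)
    fix j assume "j \<in> {..<J}"
    have "0 \<le> (x - snd p j)\<^sup>2" by simp
    then show "exp (snd p j * x - (snd p j)\<^sup>2 / 2) \<le> exp (x\<^sup>2 / 2)"
      by (simp add: power2_diff algebra_simps)
    show "0 \<le> fst p j" using param_spaceD(1)[OF assms, of j] \<open>j \<in> {..<J}\<close> by simp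
  qed
  also have "\<dots> = exp (x\<^sup>2 / 2)"
    using param_spaceD(2)[OF assms] by (simp flip: sum_distrib_right)
  finally show ?thesis .
qed

lemma tilt_deriv: "(tilt J p has_real_derivative dtilt J p x) (at x)"
  unfolding tilt_def[abs_def] dtilt_def by (auto intro!: derivative_eq_intros simp: mult_ac)

lemma mix_density_tilt: "mix_density J (fst p) (snd p) x = std_normal_density x * tilt J p x"
  unfolding mix_density_def tilt_def sum_distrib_left normal_density_def
  by (intro sum.cong) (auto simp: exp_add[symmetric] power2_diff field_simps)

lemma mix_Q_tilt:
  assumes "p \<in> mix_param_space J"
  shows "mix_Q n J (fst p) (snd p) z = - (\<Sum>i<n. ln (std_normal_density (z i))) - tilt_loglik n J p z"
  unfolding mix_Q_def tilt_loglik_def mix_density_tilt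
  by (simp add: ln_mult_pos tilt_pos[OF assms] normal_density_pos sum.distrib)

text \<open>Log-sum-exp is convex; this is its tangent form. The number \<open>m\<close> is the mean
  of \<open>snd p j * (y - x)\<close> under the weights \<open>w j\<close>, and
  \<open>exp t \<ge> 1 + t\<close> is applied to the deviations from it.\<close>

lemma ln_tilt_tangent:
  assumes p: "p \<in> mix_param_space J"
  shows "ln (tilt J p y) \<ge> ln (tilt J p x) + dtilt J p x / tilt J p x * (y - x)"
proof -
  define w where "w j = fst p j * exp (snd p j * x - (snd p j)\<^sup>2 / 2)" for j
  define m where "m = dtilt J p x / tilt J p x * (y - x)"
  have pos: "tilt J p x > 0" by (rule tilt_pos[OF p])
  have tilt: "tilt J p x = (\<Sum>j<J. w j)" and dtilt: "dtilt J p x = (\<Sum>j<J. w j * snd p j)"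
    by (simp_all add: tilt_def dtilt_def w_def)
  \<comment> \<open>By the choice of \<open>m\<close> the deviations average to zero, so the
    right-hand side is just \<open>tilt J p x\<close>.\<close>
  have "(\<Sum>j<J. w j * (1 + snd p j * (y - x) - m)) = tilt J p x + dtilt J p x * (y - x) - m * tilt J p x"
    unfolding tilt dtilt by (simp add: algebra_simps sum.distrib sum_subtractf sum_distrib_left)
  then have "tilt J p x * exp m = exp m * (\<Sum>j<J. w j * (1 + snd p j * (y - x) - m))"
    using pos by (simp add: m_def)
  also have "\<dots> = (\<Sum>j<J. w j * exp m * (1 + (snd p j * (y - x) - m)))"
    by (simp add: sum_distrib_left algebra_simps)
  also have "\<dots> \<le> (\<Sum>j<J. w j * exp m * exp (snd p j * (y - x) - m))"
    using param_spaceD(1)[OF p] by (intro sum_mono mult_left_mono exp_ge_add_one_self) (auto simp: w_def less_imp_le)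
  also have "\<dots> = tilt J p y"
    unfolding tilt_def w_def by (intro sum.cong) (auto simp: exp_add[symmetric] algebra_simps)
  finally have "ln (tilt J p x * exp m) \<le> ln (tilt J p y)"
    using pos tilt_pos[OF p, of y] by simp
  then show ?thesis using pos by (simp add: ln_mult_pos m_def)
qed

section \<open>Identifiability of the parameters\<close>

text \<open>Exponentials with distinct exponents are linearly independent, so coefficients are
  proportional. Positive ones mark the means, the ordering fixes their indices, and the weights
  summing to 1 give \<open>C = 1\<close>.\<close>

lemma proportional_tilt_imp_eq:
  assumes p: "p \<in> mix_param_space J" and q: "q \<in> mix_param_space J"
    and proportional: "\<And>x. tilt J p x = C * tilt J q x"
  shows "p = q"
proof -
  \<comment> \<open>The coefficient of \<open>exp (a * x)\<close>, zero if \<open>a\<close> is not a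
    mean; both tilts can thus be expanded over the common set \<open>A\<close>.\<close>
  define k where "k p a = (\<Sum>j | j \<in> {..<J} \<and> snd p j = a. fst p j * exp (- (a\<^sup>2 / 2)))"
    for p :: "(nat \<Rightarrow> real) \<times> (nat \<Rightarrow> real)" and a
  define A where "A = snd p ` {..<J} \<union> snd q ` {..<J}"
  have tilt_k: "tilt J r x = (\<Sum>a\<in>A. k r a * exp (a * x))" if "r = p \<or> r = q" for r x
  proof -
    have "tilt J r x = (\<Sum>a\<in>A. \<Sum>j | j \<in> {..<J} \<and> snd r j = a. fst r j * exp (snd r j * x - (snd r j)\<^sup>2 / 2))"
      unfolding tilt_def using that by (intro sum.group[symmetric]) (auto simp: A_def)
    also have "\<dots> = (\<Sum>a\<in>A. k r a * exp (a * x))"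
      unfolding k_def sum_distrib_right by (intro sum.cong) (auto simp: mult.assoc exp_add[symmetric])
    finally show ?thesis .
  qed
  have C: "C > 0"
    using proportional[of 0] tilt_pos[OF p, of 0] tilt_pos[OF q, of 0] by (simp add: zero_less_mult_iff)
  have k_eq: "k p a = C * k q a" if "a \<in> A" for a
  proof -
    have "k p a - C * k q a = 0"
    \<comment> \<open>The difference vanishes everywhere, so any \<open>card A\<close> points serve
      as zeros.\<close>
    proof (rule exp_sum_coeffs_zero[of A "real ` {..<card A}" "\<lambda>a. k p a - C * k q a"])
      show "card A \<le> card (real ` {..<card A})" by (simp add: card_image inj_on_def)
      show "(\<Sum>a\<in>A. (k p a - C * k q a) * exp (a * x)) = 0" for x
        using proportional[of x] by (simp add: tilt_k left_diff_distrib sum_subtractf sum_distrib_left mult.assoc)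
    qed (use that in \<open>auto simp: A_def\<close>)
    then show ?thesis by simp
  qed
  have k_val: "k r (snd r j) = fst r j * exp (- ((snd r j)\<^sup>2 / 2))"
    if "r \<in> mix_param_space J" "j < J" for r j
  proof -
    have "{i. i \<in> {..<J} \<and> snd r i = snd r j} = {j}"
      using strict_mono_on_imp_inj_on[OF param_space_strict_mono[OF that(1)]] that(2)
      by (auto simp: inj_on_def)
    then show ?thesis by (simp add: k_def)
  qed
  have k_pos: "k r a > 0 \<longleftrightarrow> a \<in> snd r ` {..<J}" if r: "r \<in> mix_param_space J" for r a
  proof (cases "a \<in> snd r ` {..<J}")
    case True
    then show ?thesis using k_val[OF r] param_spaceD(1)[OF r] by auto
  next
    case False
    then have "{j. j \<in> {..<J} \<and> snd r j = a} = {}" by auto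
    then have "k r a = 0" unfolding k_def by (simp only: sum.empty)
    then show ?thesis using False by simp
  qed
  have "a \<in> snd p ` {..<J} \<longleftrightarrow> a \<in> snd q ` {..<J}" for a
  proof (cases "a \<in> A")
    case True
    then show ?thesis using k_eq[OF True] C k_pos[OF p, of a] k_pos[OF q, of a]
      by (simp add: zero_less_mult_iff)
  qed (auto simp: A_def)
  then have img: "snd p ` {..<J} = snd q ` {..<J}" by blast
  have mu: "snd p j = snd q j" if "j < J" for j
    by (rule strict_mono_on_image_unique[OF param_space_strict_mono[OF p] param_space_strict_mono[OF q] img that])
  have tau: "fst p j = C * fst q j" if "j < J" for j
    using k_eq[of "snd p j"] k_val[OF p that] k_val[OF q that] mu[OF that] that by (auto simp: A_def)
  have "1 = C"
    using param_spaceD(2)[OF p] param_spaceD(2)[OF q] tau by (simp flip: sum_distrib_left)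
  \<comment> \<open>Beyond \<open>J\<close> both sides have the default value 0, so the sequences
    agree as functions.\<close>
  then have "fst p j = fst q j" "snd p j = snd q j" for j
    using tau[of j] mu[of j] param_spaceD(4,5)[OF p, of j] param_spaceD(4,5)[OF q, of j]
    by (cases "j < J"; simp)+
  then show ?thesis by (simp add: prod_eq_iff fun_eq_iff)
qed

lemma tilt_slopes_determine:
  assumes p: "p \<in> mix_param_space J" and q: "q \<in> mix_param_space J"
    and Z: "finite Z" "J\<^sup>2 \<le> card Z"
    and slopes: "\<And>x. x \<in> Z \<Longrightarrow> dtilt J p x / tilt J p x = dtilt J q x / tilt J q x"
  shows "p = q"
proof -
  define c where "c = (\<lambda>(i, j). fst p i * fst q j * (snd p i - snd q j) *
    exp (- (snd p i)\<^sup>2 / 2 - (snd q j)\<^sup>2 / 2))"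
  define e where "e = (\<lambda>(i, j). snd p i + snd q j)"
  define wronskian where "wronskian x = dtilt J p x * tilt J q x - tilt J p x * dtilt J q x" for x
  have eq: "wronskian x = (\<Sum>s\<in>{..<J} \<times> {..<J}. c s * exp (e s * x))" for x
  proof -
    have "wronskian x = (\<Sum>i<J. \<Sum>j<J. fst p i * fst q j * (snd p i - snd q j) *
        (exp (snd p i * x - (snd p i)\<^sup>2 / 2) * exp (snd q j * x - (snd q j)\<^sup>2 / 2)))"
      unfolding wronskian_def tilt_def dtilt_def sum_product sum_subtractf[symmetric]
      by (intro sum.cong) (auto simp: algebra_simps)
    also have "\<dots> = (\<Sum>i<J. \<Sum>j<J. c (i, j) * exp (e (i, j) * x))"
    proof (intro sum.cong refl)
      fix i j
      have "exp (snd p i * x - (snd p i)\<^sup>2 / 2) * exp (snd q j * x - (snd q j)\<^sup>2 / 2) =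
          exp (- (snd p i)\<^sup>2 / 2 - (snd q j)\<^sup>2 / 2) * exp (e (i, j) * x)"
        by (simp only: mult_exp_exp e_def prod.case) (simp add: algebra_simps)
      then show "fst p i * fst q j * (snd p i - snd q j) *
          (exp (snd p i * x - (snd p i)\<^sup>2 / 2) * exp (snd q j * x - (snd q j)\<^sup>2 / 2)) =
          c (i, j) * exp (e (i, j) * x)"
        by (simp add: c_def)
    qed
    finally show ?thesis by (simp add: sum.cartesian_product)
  qed
  have pos: "tilt J p x > 0" "tilt J q x > 0" for x using tilt_pos p q by blast+
  \<comment> \<open>Equal logarithmic derivatives at \<open>x\<close> mean a zero of the Wronskian;
    its exponents are indexed by \<open>J\<^sup>2\<close> pairs, so these zeros suffice.\<close>
  have "wronskian x = 0" if "x \<in> Z" for x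
    using slopes[OF that] pos[of x] by (simp add: wronskian_def field_simps)
  then have zero: "wronskian x = 0" for x
    unfolding eq using Z exp_sum_identically_zero[of "{..<J} \<times> {..<J}" Z c e x]
    by (simp add: power2_eq_square)
  have "((\<lambda>x. tilt J p x / tilt J q x) has_real_derivative 0) (at x)" for x
  proof -
    have "((\<lambda>x. tilt J p x / tilt J q x) has_real_derivative
        (dtilt J p x * tilt J q x - tilt J p x * dtilt J q x) / (tilt J q x * tilt J q x)) (at x)"
      using pos(2)[of x] by (intro DERIV_divide tilt_deriv) auto
    then show ?thesis using zero[of x] by (simp add: wronskian_def)
  qed
  then have "tilt J p x / tilt J q x = tilt J p 0 / tilt J q 0" for x
    using DERIV_isconst_all by blast
  then have "tilt J p x = tilt J p 0 / tilt J q 0 * tilt J q x" for x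
    using pos(2)[of x] by (metis less_irrefl nonzero_divide_eq_eq)
  then show ?thesis by (rule proportional_tilt_imp_eq[OF p q])
qed

section \<open>The profile likelihood and its kinks\<close>

text \<open>This is the convex function \<open>W\<close> of the introduction;
  \<open>bdd_above_tilt_loglik\<close> makes the real supremum meaningful.\<close>

definition profile :: "nat \<Rightarrow> nat \<Rightarrow> (nat \<Rightarrow> real) \<Rightarrow> real" where
  "profile n J z = (SUP p\<in>mix_param_space J. tilt_loglik n J p z)"

text \<open>Rational shifts keep this set measurable; by quasiconvexity they are enough to make the points
  strict minima along the coordinate line.\<close>

definition kink :: "nat \<Rightarrow> nat \<Rightarrow> nat \<Rightarrow> real \<Rightarrow> (nat \<Rightarrow> real) set" where
  "kink n J i r = {z \<in> space (\<Pi>\<^sub>M i\<in>{..<n}. borel).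
     \<forall>s\<in>\<rat> - {0}. profile n J z + r * s < profile n J (z(i := z i + s))}"

text \<open>Stated for subsets because a countable dense \<open>T\<close> replaces the parameter
  space in the measurability proof.\<close>

lemma bdd_above_tilt_loglik:
  assumes "T \<subseteq> mix_param_space J"
  shows "bdd_above ((\<lambda>p. tilt_loglik n J p z) ` T)"
proof (rule bdd_aboveI2)
  fix p assume "p \<in> T"
  then have p: "p \<in> mix_param_space J" using assms by blast
  show "tilt_loglik n J p z \<le> (\<Sum>i<n. (z i)\<^sup>2 / 2)"
    unfolding tilt_loglik_def
  proof (rule sum_mono)
    fix i
    show "ln (tilt J p (z i)) \<le> (z i)\<^sup>2 / 2"
      using ln_mono[OF tilt_le[OF p] tilt_pos[OF p]] by simp
  qed
qed

lemma tilt_loglik_le_profile: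
  "p \<in> mix_param_space J \<Longrightarrow> tilt_loglik n J p z \<le> profile n J z"
  unfolding profile_def by (intro cSUP_upper bdd_above_tilt_loglik order_refl)

lemma tilt_loglik_tangent:
  assumes p: "p \<in> mix_param_space J" and i: "i < n"
  shows "tilt_loglik n J p (z(i := x)) + dtilt J p x / tilt J p x * (y - x) \<le> tilt_loglik n J p (z(i := y))"
proof -
  have "tilt_loglik n J p (z(i := u)) = ln (tilt J p u) + (\<Sum>k\<in>{..<n} - {i}. ln (tilt J p (z k)))" for u
    unfolding tilt_loglik_def using i by (subst sum.remove[of _ i]) auto
  then show ?thesis using ln_tilt_tangent[OF p, of x y] by simp
qed

text \<open>For each \<open>p\<close>, the tangent at \<open>y\<close> bounds the profile from
  below. After subtracting \<open>r * u\<close> its slope is \<open>d - r\<close>, so it does not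
  descend towards \<open>x\<close> or towards \<open>w\<close>, according to sign.\<close>

lemma profile_quasiconvex:
  assumes P: "mix_param_space J \<noteq> {}" and i: "i < n" and xyw: "x < y" "y < w"
  shows "profile n J (z(i := y)) - r * y \<le> max (profile n J (z(i := x)) - r * x) (profile n J (z(i := w)) - r * w)"
    (is "_ \<le> ?m")
proof -
  have "profile n J (z(i := y)) \<le> ?m + r * y"
    unfolding profile_def[of n J "z(i := y)"]
  proof (rule cSUP_least[OF P])
    fix p assume p: "p \<in> mix_param_space J"
    define d where "d = dtilt J p y / tilt J p y"
    have tangent: "tilt_loglik n J p (z(i := y)) + d * (u - y) \<le> profile n J (z(i := u))" for u
      using tilt_loglik_tangent[OF p i, of z y u] tilt_loglik_le_profile[OF p, of n "z(i := u)"]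
      by (simp add: d_def)
    show "tilt_loglik n J p (z(i := y)) \<le> ?m + r * y"
    proof (cases "d \<le> r")
      case True
      then have "(r - d) * (y - x) \<ge> 0" using xyw by simp
      then show ?thesis using tangent[of x] by (simp add: algebra_simps max_def)
    next
      case False
      then have "(d - r) * (w - y) \<ge> 0" using xyw by simp
      then show ?thesis using tangent[of w] by (simp add: algebra_simps max_def)
    qed
  qed
  then show ?thesis by simp
qed

lemma kink_unique:
  assumes P: "mix_param_space J \<noteq> {}" and i: "i < n"
    and x: "z(i := x) \<in> kink n J i r" and y: "z(i := y) \<in> kink n J i r"
  shows "x = y"
proof -
  define h where "h u = profile n J (z(i := u)) - r * u" for u
  have strict: "h u < h (u + s)" if "z(i := u) \<in> kink n J i r" "s \<in> \<rat>" "s \<noteq> 0" for u s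
  proof -
    have "profile n J (z(i := u)) + r * s < profile n J (z(i := u + s))"
      using that by (auto simp: kink_def)
    then show ?thesis by (simp add: h_def distrib_left)
  qed
  \<comment> \<open>The conclusion is deliberately contradictory: a small rational step inwards from
    either end raises \<open>h\<close> strictly, yet stays below the maximum of the end values, so
    each end value is below the other.\<close>
  have less: "h u < h v \<and> h v < h u"
    if "u < v" "z(i := u) \<in> kink n J i r" "z(i := v) \<in> kink n J i r" for u v
  proof -
    obtain s where s: "s \<in> \<rat>" "0 < s" "s < v - u"
      using Rats_dense_in_real[of 0 "v - u"] \<open>u < v\<close> by auto
    have "h (u + s) \<le> max (h u) (h v)" "h (v + - s) \<le> max (h u) (h v)"
      using s profile_quasiconvex[OF P i, of u "u + s" v z r] profile_quasiconvex[OF P i, of u "v + - s" v z r]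
      by (simp_all add: h_def)
    moreover have "h u < h (u + s)" "h v < h (v + - s)"
      using s strict[OF that(2), of s] strict[OF that(3), of "- s"] by simp_all
    ultimately show ?thesis by linarith
  qed
  show ?thesis
    using less[OF _ x y] less[OF _ y x] by (metis linorder_neqE less_asym)
qed

text \<open>At an optimal parameter the tilted log-likelihood touches the profile, so its tangent
  supports the profile. The steeper tangent, of \<open>q\<close>, serves for \<open>s > 0\<close>,
  that of \<open>p\<close> for \<open>s < 0\<close>.\<close>

lemma argmin_imp_kink:
  assumes p: "p \<in> mix_argmin n J z" and q: "q \<in> mix_argmin n J z" and i: "i < n"
    and z: "z \<in> space (\<Pi>\<^sub>M i\<in>{..<n}. borel)"
    and r: "dtilt J p (z i) / tilt J p (z i) < r" "r < dtilt J q (z i) / tilt J q (z i)"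
  shows "z \<in> kink n J i r"
proof -
  have maximiser: "t \<in> mix_param_space J \<and> tilt_loglik n J t z = profile n J z"
    if "t \<in> mix_argmin n J z" for t
  proof -
    have t: "t \<in> mix_param_space J"
      and "\<And>u. u \<in> mix_param_space J \<Longrightarrow> mix_Q n J (fst t) (snd t) z \<le> mix_Q n J (fst u) (snd u) z"
      using that by (auto simp: mix_argmin_def)
    then have "\<And>u. u \<in> mix_param_space J \<Longrightarrow> tilt_loglik n J u z \<le> tilt_loglik n J t z"
      by (simp add: mix_Q_tilt)
    then have "profile n J z \<le> tilt_loglik n J t z"
      unfolding profile_def using t by (intro cSUP_least) auto
    then show ?thesis using tilt_loglik_le_profile[OF t, of n z] t by simp
  qed
  have tangent: "profile n J z + dtilt J t (z i) / tilt J t (z i) * s \<le> profile n J (z(i := z i + s))"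
    if "t \<in> mix_argmin n J z" for t s
    using tilt_loglik_tangent[of t J i n z "z i" "z i + s"] maximiser[OF that] i
      tilt_loglik_le_profile[of t J n "z(i := z i + s)"] by simp
  have "profile n J z + r * s < profile n J (z(i := z i + s))" if "s \<noteq> 0" for s
  proof (cases "s > 0")
    case True
    then have "r * s < dtilt J q (z i) / tilt J q (z i) * s"
      using r by (intro mult_strict_right_mono) auto
    then show ?thesis using tangent[OF q, of s] by linarith
  next
    case False
    then have "r * s < dtilt J p (z i) / tilt J p (z i) * s"
      using r that by (intro mult_strict_right_mono_neg) auto
    then show ?thesis using tangent[OF p, of s] by linarith
  qed
  then show ?thesis using z by (simp add: kink_def)
qed

section \<open>Measurability of the profile and of the kink sets\<close>

lemma borel_measurable_tilt_loglik:
  "tilt_loglik n J p \<in> borel_measurable (\<Pi>\<^sub>M i\<in>{..<n}. borel)"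
  unfolding tilt_loglik_def[abs_def] tilt_def by measurable

lemma continuous_on_tilt_loglik:
  "continuous_on (mix_param_space J) (\<lambda>p. tilt_loglik n J p z)"
proof -
  have "continuous_on S (\<lambda>p::(nat \<Rightarrow> real) \<times> (nat \<Rightarrow> real). fst p j)"
    "continuous_on S (\<lambda>p::(nat \<Rightarrow> real) \<times> (nat \<Rightarrow> real). snd p j)" for S j
    by (rule continuous_on_product_then_coordinatewise, intro continuous_intros)+
  then have "continuous_on S (\<lambda>p. tilt J p x)" for S x
    unfolding tilt_def by (intro continuous_intros) auto
  then show ?thesis
    unfolding tilt_loglik_def by (intro continuous_intros ballI less_imp_neq[OF tilt_pos, symmetric])
qed

text \<open>Continuity in \<open>p\<close>, for the product topology on sequences, reduces the
  uncountable supremum to one over a countable dense set.\<close>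

lemma borel_measurable_profile: "profile n J \<in> borel_measurable (\<Pi>\<^sub>M i\<in>{..<n}. borel)"
proof -
  obtain T where T: "countable T" "T \<subseteq> mix_param_space J" "mix_param_space J \<subseteq> closure T"
    by (rule separable)
  have "profile n J z = (SUP p\<in>T. tilt_loglik n J p z)" for z
  proof (cases "T = {}")
    case True
    then show ?thesis using T by (simp add: profile_def)
  next
    case False
    have "tilt_loglik n J p z \<le> (SUP p\<in>T. tilt_loglik n J p z)" if p: "p \<in> mix_param_space J" for p
    proof -
      obtain t where t: "\<And>k. t k \<in> T" "t \<longlonglongrightarrow> p"
        using T(3) p closure_sequential by blast
      have "(\<lambda>k. tilt_loglik n J (t k) z) \<longlonglongrightarrow> tilt_loglik n J p z"
        using t T(2) p by (intro continuous_on_tendsto_compose[OF continuous_on_tilt_loglik] always_eventually) auto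
      moreover have "tilt_loglik n J (t k) z \<le> (SUP p\<in>T. tilt_loglik n J p z)" for k
        using t T(2) by (intro cSUP_upper bdd_above_tilt_loglik)
      ultimately show ?thesis by (intro LIMSEQ_le_const2) auto
    qed
    then show ?thesis
      unfolding profile_def using False T(2)
      by (intro antisym cSUP_least cSUP_subset_mono bdd_above_tilt_loglik order_refl) auto
  qed
  then have "profile n J = (\<lambda>z. SUP p\<in>T. tilt_loglik n J p z)" by (rule ext)
  then show ?thesis
    using T by (simp only:)
      (intro borel_measurable_cSUP borel_measurable_tilt_loglik bdd_above_tilt_loglik)
qed

lemma sets_kink:
  assumes i: "i < n"
  shows "kink n J i r \<in> sets (\<Pi>\<^sub>M i\<in>{..<n}. borel)"
proof -
  let ?M = "\<Pi>\<^sub>M i\<in>{..<n}. (borel :: real measure)"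
  have "(\<lambda>z. profile n J (z(i := z i + s))) \<in> borel_measurable ?M" for s
  proof (rule measurable_compose[OF _ borel_measurable_profile])
    have [measurable]: "(\<lambda>z. z i) \<in> borel_measurable ?M"
      using i by (intro measurable_component_singleton) auto
    show "(\<lambda>z. z(i := z i + s)) \<in> measurable ?M ?M"
      using i by (intro measurable_fun_upd[of _ "{..<n}"]) auto
  qed
  note [measurable] = this borel_measurable_profile
  have "{z \<in> space ?M. profile n J z + r * s < profile n J (z(i := z i + s))} \<in> sets ?M" for s
    by measurable
  \<comment> \<open>The witness 1 shows the index set nonempty, so the intersection stays inside the
    space.\<close>
  moreover have "kink n J i r = (\<Inter>s\<in>\<rat> - {0}. {z \<in> space ?M. profile n J z + r * s < profile n J (z(i := z i + s))})"
    unfolding kink_def using Rats_1 by (auto intro!: bexI[of _ 1])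
  ultimately show ?thesis
    using Rats_1 by (auto intro!: sets.countable_INT' simp: countable_rat)
qed

section \<open>Null sets of graphs\<close>

text \<open>Fubini, integrating over coordinate \<open>i\<close> first: each line in that direction
  meets \<open>B\<close> in at most one point, which has measure zero.\<close>

lemma (in product_sigma_finite) AE_PiM_not_in_graph:
  assumes I: "finite I" "i \<in> I" and atomless: "\<And>x. x \<in> space (M i) \<Longrightarrow> {x} \<in> null_sets (M i)"
    and B: "B \<in> sets (Pi\<^sub>M I M)"
    and graph: "\<And>z x y. z(i := x) \<in> B \<Longrightarrow> z(i := y) \<in> B \<Longrightarrow> x = y"
  shows "AE z in Pi\<^sub>M I M. z \<notin> B"
proof -
  define K where "K = I - {i}"
  have I_eq: "insert i K = I" using I by (auto simp: K_def)
  have "emeasure (Pi\<^sub>M I M) B = (\<integral>\<^sup>+z. indicator B z \<partial>Pi\<^sub>M (insert i K) M)"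
    using B by (simp add: I_eq)
  also have "\<dots> = (\<integral>\<^sup>+z. (\<integral>\<^sup>+x. indicator B (z(i := x)) \<partial>M i) \<partial>Pi\<^sub>M K M)"
    using I B by (intro product_nn_integral_insert) (auto simp: K_def insert_absorb)
  also have "\<dots> = (\<integral>\<^sup>+z. 0 \<partial>Pi\<^sub>M K M)"
  proof (intro nn_integral_cong)
    fix z
    have "(\<integral>\<^sup>+x. indicator B (z(i := x)) \<partial>M i) \<le> 0"
    proof (cases "\<exists>x\<in>space (M i). z(i := x) \<in> B")
      case True
      then obtain x0 where x0: "x0 \<in> space (M i)" "z(i := x0) \<in> B" by blast
      have "(\<integral>\<^sup>+x. indicator B (z(i := x)) \<partial>M i) \<le> (\<integral>\<^sup>+x. indicator {x0} x \<partial>M i)"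
        using graph[OF x0(2)] by (intro nn_integral_mono) (auto simp: indicator_def)
      also have "\<dots> \<le> 0"
        using atomless[OF x0(1)] by (simp add: null_sets_def)
      finally show ?thesis .
    next
      case False
      then have "(\<integral>\<^sup>+x. indicator B (z(i := x)) \<partial>M i) = (\<integral>\<^sup>+x. 0 \<partial>M i)"
        by (intro nn_integral_cong) (auto simp: indicator_def)
      then show ?thesis by simp
    qed
    then show "(\<integral>\<^sup>+x. indicator B (z(i := x)) \<partial>M i) = 0" by simp
  qed
  finally have "emeasure (Pi\<^sub>M I M) B = 0" by simp
  then show ?thesis using B by (intro AE_not_in) (auto simp: null_sets_def)
qed

section \<open>Almost sure uniqueness of the minimiser\<close>

theorem theorem1:
  fixes g :: "real \<Rightarrow> real" and n J :: nat
  assumes g_meas: "g \<in> borel_measurable borel"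
    and g_nonneg: "\<And>x. g x \<ge> 0"
    and g_prob: "prob_space (density lborel (\<lambda>x. ennreal (g x)))"
    and J_pos: "J > 0"
    and J_le: "real J \<le> sqrt (real n)"
  shows "AE z in (\<Pi>\<^sub>M i\<in>{..<n}. density lborel (\<lambda>x. ennreal (g x))).
           \<forall>p\<in>mix_argmin n J z. \<forall>q\<in>mix_argmin n J z. p = q"
proof (cases "mix_param_space J = {}")
  case True
  then show ?thesis by (simp add: mix_argmin_def)
next
  case P: False
  let ?D = "density lborel (\<lambda>x. ennreal (g x))"
  let ?M = "\<Pi>\<^sub>M i\<in>{..<n}. ?D"
  interpret D: prob_space ?D by (rule g_prob)
  interpret product_sigma_finite "\<lambda>i::nat. ?D"
    by unfold_locales
  have atomless: "{x} \<in> null_sets ?D" for x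
    using g_meas by (simp add: emeasure_density nn_integral_null_set[of "{x}" lborel] null_sets_def)
  have sets_M: "sets ?M = sets (\<Pi>\<^sub>M i\<in>{..<n}. borel)"
    by (intro sets_PiM_cong) auto
  note space_M = sets_eq_imp_space_eq[OF sets_M]
  have "AE z in ?M. z \<notin> kink n J i r" if "i < n" for i r
    by (rule AE_PiM_not_in_graph[of _ i])
      (use that atomless sets_kink[OF that] kink_unique[OF P that] in \<open>auto simp: sets_M\<close>)
  \<comment> \<open>Only countably many pairs of a coordinate and a rational slope occur, so the
    exceptional sets can be discarded together.\<close>
  then have kinks: "AE z in ?M. \<forall>i\<in>{..<n}. \<forall>r\<in>\<rat>. z \<notin> kink n J i r"
    by (intro AE_ball_countable' countable_rat) auto
  have "AE z in ?M. z i \<noteq> z j" if "i < n" "j < n" "i \<noteq> j" for i j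
  proof -
    have [measurable]: "(\<lambda>z. z k) \<in> borel_measurable ?M" if "k < n" for k
      using measurable_component_singleton[of k "{..<n}" "\<lambda>_. ?D"] that by simp
    have "{z \<in> space ?M. z i = z j} \<in> sets ?M"
      using that by measurable
    \<comment> \<open>Since \<open>i \<noteq> j\<close>, changing coordinate \<open>i\<close> leaves
      \<open>z j\<close> fixed, so a tie determines \<open>z i\<close>.\<close>
    then have "AE z in ?M. z \<notin> {z \<in> space ?M. z i = z j}"
      by (intro AE_PiM_not_in_graph[of _ i]) (use that atomless in auto)
    then show ?thesis by (rule AE_mp) auto
  qed
  then have "AE z in ?M. \<forall>i\<in>{..<n}. \<forall>j\<in>{..<n} - {i}. z i \<noteq> z j"
    by (intro AE_ball_countable') auto
  with kinks AE_space show ?thesis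
  proof eventually_elim
    case (elim z)
    have inj: "inj_on z {..<n}" using elim(3) by (force simp: inj_on_def)
    have "sqrt (real n) ^ 2 = real n" by simp
    then have "real (J\<^sup>2) \<le> real n" using power_mono[OF J_le, of 2] by simp
    then have card: "J\<^sup>2 \<le> card (z ` {..<n})" using inj by (simp add: card_image del: of_nat_power)
    \<comment> \<open>A rational strictly between two different slopes would make \<open>z\<close> a
      kink. Using the claim for both orders of \<open>p\<close> and \<open>q\<close> gives
      equality.\<close>
    have le: "dtilt J q (z i) / tilt J q (z i) \<le> dtilt J p (z i) / tilt J p (z i)"
      if "p \<in> mix_argmin n J z" "q \<in> mix_argmin n J z" "i < n" for p q i
    proof (rule ccontr)
      assume "\<not> ?thesis"
      then obtain r where "r \<in> \<rat>" "dtilt J p (z i) / tilt J p (z i) < r" "r < dtilt J q (z i) / tilt J q (z i)"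
        using Rats_dense_in_real by (metis not_le)
      then show False using argmin_imp_kink[OF that] elim(1,2) that by (auto simp: space_M)
    qed
    show ?case
    proof (intro ballI)
      fix p q assume pq: "p \<in> mix_argmin n J z" "q \<in> mix_argmin n J z"
      then have "p \<in> mix_param_space J" "q \<in> mix_param_space J" by (auto simp: mix_argmin_def)
      then show "p = q"
        by (rule tilt_slopes_determine[OF _ _ _ card]) (use le[OF pq] le[OF pq(2,1)] in \<open>auto intro!: antisym\<close>)
    qed
  qed
qed

end
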